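(* Let $h\in SL(2,\mathbf{Z})$ be hyperbolic and not conjugate to its inverse in $SL(2,\mathbf{Z})$. Then there exists a homogeneous quasi-morphism $r$ of $SL(2,\mathbf{Z})$ such that $r(h)=1$ and $r$ vanishes on all parabolic elements of $SL(2,\mathbf{Z})$.
   Context: Given a group $G$, a function $r:G\to\mathbf{R}$ is a quasi-morphism if the function $dr:G\times G\to\mathbf{R}$, $dr(g_1,g_2)=r(g_1g_2)-r(g_1)-r(g_2)$, is bounded. A quasi-morphism $r$ is homogeneous if in addition $r(g^n)=n\,r(g)$ for all $g\in G$, $n\in\mathbf{Z}$. An element of $SL(2,\mathbf{Z})$ is hyperbolic if $|\operatorname{trace}|>2$, and parabolic if $|\operatorname{trace}|=2$ and it is not $\pm I$. *)

theory Defs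
  imports "HOL-Analysis.Analysis" "HOL-Algebra.Group"
begin

text \<open>Quasi-morphisms are functions on the whole type; only their values on the carrier matter.\<close>

definition coboundary :: "('a, 'b) monoid_scheme \<Rightarrow> ('a \<Rightarrow> real) \<Rightarrow> 'a \<times> 'a \<Rightarrow> real" where
  "coboundary G r = (\<lambda>(g1, g2). r (g1 \<otimes>\<^bsub>G\<^esub> g2) - r g1 - r g2)"

definition quasi_morphism :: "('a, 'b) monoid_scheme \<Rightarrow> ('a \<Rightarrow> real) \<Rightarrow> bool" where
  "quasi_morphism G r \<longleftrightarrow> bounded (coboundary G r ` (carrier G \<times> carrier G))"

definition homogeneous_quasi_morphism :: "('a, 'b) monoid_scheme \<Rightarrow> ('a \<Rightarrow> real) \<Rightarrow> bool" where
  "homogeneous_quasi_morphism G r \<longleftrightarrow>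
     quasi_morphism G r \<and> (\<forall>g\<in>carrier G. \<forall>n::int. r (g [^]\<^bsub>G\<^esub> n) = of_int n * r g)"

definition conjugate_in :: "('a, 'b) monoid_scheme \<Rightarrow> 'a \<Rightarrow> 'a \<Rightarrow> bool" where
  "conjugate_in G x y \<longleftrightarrow> (\<exists>g\<in>carrier G. g \<otimes>\<^bsub>G\<^esub> x \<otimes>\<^bsub>G\<^esub> inv\<^bsub>G\<^esub> g = y)"

definition SL2Z :: "(int^2^2) monoid" where
  "SL2Z = \<lparr>carrier = {A. det A = 1}, mult = (**), one = mat 1\<rparr>"

definition hyperbolic :: "int^2^2 \<Rightarrow> bool" where
  "hyperbolic A \<longleftrightarrow> A \<in> carrier SL2Z \<and> \<bar>trace A\<bar> > 2"

definition parabolic :: "int^2^2 \<Rightarrow> bool" where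
  "parabolic A \<longleftrightarrow> A \<in> carrier SL2Z \<and> \<bar>trace A\<bar> = 2 \<and> A \<noteq> mat 1 \<and> A \<noteq> - mat 1"

lemma group_SL2Z: "group SL2Z"
proof (rule groupI)
  fix A assume "A \<in> carrier SL2Z"
  then have d: "A$1$1 * A$2$2 - A$1$2 * A$2$1 = 1"
    by (simp add: SL2Z_def det_2)
  let ?B = "vector [vector [A$2$2, - A$1$2], vector [- A$2$1, A$1$1]] :: int^2^2"
  have "det ?B = 1" "?B ** A = mat 1"
    using d by (simp_all add: det_2 vec_eq_iff forall_2 matrix_matrix_mult_def sum_2 mat_def algebra_simps)
  then show "\<exists>B\<in>carrier SL2Z. B \<otimes>\<^bsub>SL2Z\<^esub> A = \<one>\<^bsub>SL2Z\<^esub>"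
    by (auto simp: SL2Z_def)
qed (auto simp: SL2Z_def det_mul matrix_mul_assoc)

end

theory Submission
  imports Defs
begin

text \<open>
  Modulo sign, \<open>SL(2,\<int>)\<close> is the free product of a cyclic group of order 2, generated by \<open>S\<close>, and one
  of order 3, generated by \<open>U\<close>; its elements have normal forms in which \<open>S\<close> alternates with powers
  of \<open>U\<close>. Every matrix \<open>g\<close> with \<open>\<bar>trace g\<bar> \<ge> 2\<close> is conjugate, up to sign, to the value of a cyclically
  reduced word composed of blocks \<open>S U\<close> and \<open>S U\<^bsup>-1\<^esup>\<close> (\<open>conjugate_to_positive_word\<close>). These blocks
  represent the upper and the lower elementary matrix, so both kinds occur if and only if the matrix
  is hyperbolic (\<open>positive_word_hyperbolic_iff\<close>).

  Let \<open>w\<close> be such a word for \<open>h\<close>. As in the construction of Brooks, count the occurrences of \<open>w\<close> in the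
  normal form of a matrix, minus those of the inverse word. When two normal forms are
  multiplied, a segment cancels against its inverse and at most two letters merge
  (\<open>reduced_product\<close>); the cancelled segments contribute opposite counts, so this is a quasi-morphism
  (\<open>counting_function_defect\<close>). Its homogenization is invariant under conjugation and change of sign,
  and is given on positive words by the asymptotic count in their powers (\<open>homogenized_counting\<close>).

  A parabolic element has only blocks of one kind, so neither \<open>w\<close> nor its inverse occurs in any
  power, and the value is 0. In \<open>w ^ n\<close> there are at least \<open>n\<close> occurrences of \<open>w\<close>. If the inverse of
  \<open>w\<close> occurred there, having the same length as \<open>w\<close>, it would be a rotation of \<open>w\<close>
  (\<open>factor_of_power_is_rotation\<close>), and \<open>h\<close> would be conjugate to its inverse, the sign being settled by
  the trace. So the value at \<open>h\<close> is positive and can be scaled to 1.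
\<close>

section \<open>Homogenization of quasi-morphisms\<close>

lemma almost_additive_multiple:
  fixes a :: "nat \<Rightarrow> real"
  assumes D: "\<And>m n. \<bar>a (m + n) - a m - a n\<bar> \<le> D"
  shows "\<bar>a (m * n) - m * a n\<bar> \<le> (real m + 1) * D"
proof (induction m)
  case 0
  show ?case using D[of 0 0] by simp
next
  case (Suc m)
  have "a (Suc m * n) - Suc m * a n = (a (n + m * n) - a n - a (m * n)) + (a (m * n) - m * a n)"
    by (simp add: algebra_simps)
  then show ?case using D[of n "m * n"] Suc by (simp add: algebra_simps)
qed

text \<open>
  Comparing \<open>a n / n\<close> and \<open>a m / m\<close> with \<open>a (m * n) / (m * n)\<close> shows that they differ by at
  most \<open>2 * D / m + 2 * D / n\<close>, so the quotients form a Cauchy sequence.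
\<close>

lemma almost_additive_convergent:
  fixes a :: "nat \<Rightarrow> real"
  assumes D: "\<And>m n. \<bar>a (m + n) - a m - a n\<bar> \<le> D"
  shows "convergent (\<lambda>n. a n / n)"
proof -
  have D0: "D \<ge> 0" using D[of 0 0] by linarith
  have half: "\<bar>a (m * n) / (m * n) - a n / n\<bar> \<le> 2 * D / n" if "m > 0" "n > 0" for m n :: nat
  proof -
    have "\<bar>a (m * n) - m * a n\<bar> \<le> (real m + 1) * D" by (rule almost_additive_multiple[OF D])
    also have "\<dots> \<le> 2 * m * D" using that D0 by (intro mult_right_mono) auto
    finally have *: "\<bar>a (m * n) - m * a n\<bar> \<le> 2 * m * D" .
    have "a (m * n) / (m * n) - a n / n = (a (m * n) - m * a n) / (m * n)"
      using that by (simp add: field_simps)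
    then have "\<bar>a (m * n) / (m * n) - a n / n\<bar> = \<bar>a (m * n) - m * a n\<bar> / (m * n)"
      by simp
    also have "\<dots> \<le> 2 * m * D / (m * n)" using * by (intro divide_right_mono) auto
    also have "\<dots> = 2 * D / n" using that by simp
    finally show ?thesis .
  qed
  have near: "\<bar>a m / m - a n / n\<bar> \<le> 2 * D / m + 2 * D / n" if "m > 0" "n > 0" for m n :: nat
    using half[of m n] half[of n m] that by (simp add: mult.commute)
  have "Cauchy (\<lambda>n. a n / n)"
  proof (rule CauchyI)
    fix e :: real assume e: "e > 0"
    obtain N :: nat where N: "N > 4 * D / e" using reals_Archimedean2 by blast
    have small: "2 * D / n < e / 2 \<and> n > 0" if "n \<ge> Suc N" for n
    proof -
      have "4 * D / e < n" using N that by linarith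
      then show ?thesis using e that by (simp add: field_simps)
    qed
    show "\<exists>M. \<forall>m\<ge>M. \<forall>n\<ge>M. norm (a m / m - a n / n) < e"
    proof (intro exI allI impI)
      fix m n assume "m \<ge> Suc N" "n \<ge> Suc N"
      then show "norm (a m / m - a n / n) < e"
        using near[of m n] small[of m] small[of n] by simp
    qed
  qed
  then show ?thesis by (simp add: Cauchy_convergent_iff)
qed

text \<open>
  The source of exact identities for a homogenization: a relation that a quasi-morphism satisfies
  only up to a constant along the powers of an element becomes exact after dividing by the
  exponent.
\<close>

lemma limit_of_bounded_difference:
  fixes a b :: "nat \<Rightarrow> real"
  assumes "(\<lambda>n. a n / n) \<longlonglongrightarrow> l" and "\<And>n. \<bar>b n - c * a n\<bar> \<le> C"
  shows "(\<lambda>n. b n / n) \<longlonglongrightarrow> c * l"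
proof -
  have "(\<lambda>n. (b n - c * a n) / n) \<longlonglongrightarrow> 0"
  proof (rule Lim_null_comparison)
    show "\<forall>\<^sub>F n in sequentially. norm ((b n - c * a n) / n) \<le> C / n"
      using assms(2) by (intro always_eventually) (simp add: divide_right_mono)
    show "(\<lambda>n. C / real n) \<longlonglongrightarrow> 0" by (rule lim_const_over_n)
  qed
  from tendsto_add[OF this tendsto_mult_left[OF assms(1), of c]]
  show ?thesis by (simp add: diff_divide_distrib)
qed

lemma quasi_morphismI:
  assumes "\<And>x y. x \<in> carrier G \<Longrightarrow> y \<in> carrier G \<Longrightarrow> \<bar>r (x \<otimes>\<^bsub>G\<^esub> y) - r x - r y\<bar> \<le> D"
  shows "quasi_morphism G r"
  unfolding quasi_morphism_def bounded_iff coboundary_def using assms by (intro exI[of _ D]) auto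

lemma quasi_morphismE:
  assumes "quasi_morphism G r"
  obtains D where "\<And>x y. x \<in> carrier G \<Longrightarrow> y \<in> carrier G \<Longrightarrow> \<bar>r (x \<otimes>\<^bsub>G\<^esub> y) - r x - r y\<bar> \<le> D"
proof -
  from assms obtain D where "\<forall>z\<in>coboundary G r ` (carrier G \<times> carrier G). norm z \<le> D"
    unfolding quasi_morphism_def bounded_iff by blast
  then have "\<bar>r (x \<otimes>\<^bsub>G\<^esub> y) - r x - r y\<bar> \<le> D" if "x \<in> carrier G" "y \<in> carrier G" for x y
    using that by (force simp: coboundary_def)
  then show ?thesis by (rule that)
qed

text \<open>
  The homogenization is \<open>r x = lim f (x ^ n) / n\<close>. Since \<open>f (x ^ (k * n))\<close> is within a constant of
  \<open>k * f (x ^ n)\<close>, and \<open>f (x ^ (- n))\<close> within a constant of \<open>- f (x ^ n)\<close>, the limit is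
  homogeneous; since it stays within a bounded distance of \<open>f\<close>, it is again a quasi-morphism.
\<close>

theorem homogenization:
  fixes f :: "'a \<Rightarrow> real"
  assumes G: "group G"
    and D: "\<And>x y. x \<in> carrier G \<Longrightarrow> y \<in> carrier G \<Longrightarrow> \<bar>f (x \<otimes>\<^bsub>G\<^esub> y) - f x - f y\<bar> \<le> D"
  obtains r where "homogeneous_quasi_morphism G r" "\<And>x. x \<in> carrier G \<Longrightarrow> \<bar>r x - f x\<bar> \<le> 2 * D"
proof -
  interpret group G by (rule G)
  define r where "r x = lim (\<lambda>n. f (x [^]\<^bsub>G\<^esub> n) / real n)" for x
  have add: "\<bar>f (x [^]\<^bsub>G\<^esub> (m + n)) - f (x [^]\<^bsub>G\<^esub> m) - f (x [^]\<^bsub>G\<^esub> n)\<bar> \<le> D"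
    if "x \<in> carrier G" for x and m n :: nat
    using D[of "x [^]\<^bsub>G\<^esub> m" "x [^]\<^bsub>G\<^esub> n"] that by (simp add: nat_pow_mult)
  have lim: "(\<lambda>n. f (x [^]\<^bsub>G\<^esub> n) / real n) \<longlonglongrightarrow> r x" if "x \<in> carrier G" for x
    using almost_additive_convergent[of "\<lambda>n. f (x [^]\<^bsub>G\<^esub> n)", OF add[OF that]]
    unfolding r_def convergent_LIMSEQ_iff .
  have r_eqI: "r y = c * r x"
    if "x \<in> carrier G" "y \<in> carrier G" "\<And>n::nat. \<bar>f (y [^]\<^bsub>G\<^esub> n) - c * f (x [^]\<^bsub>G\<^esub> n)\<bar> \<le> C" for x y c C
    by (rule LIMSEQ_unique[OF lim[OF that(2)] limit_of_bounded_difference[OF lim[OF that(1)] that(3)]])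
  have D0: "D \<ge> 0" using D[of "\<one>\<^bsub>G\<^esub>" "\<one>\<^bsub>G\<^esub>"] abs_ge_zero order_trans by blast
  have close: "\<bar>r x - f x\<bar> \<le> 2 * D" if x: "x \<in> carrier G" for x
  proof (rule LIMSEQ_le_const2)
    show "(\<lambda>n. \<bar>f (x [^]\<^bsub>G\<^esub> n) / real n - f x\<bar>) \<longlonglongrightarrow> \<bar>r x - f x\<bar>"
      by (intro tendsto_intros lim x)
    show "\<exists>N. \<forall>n\<ge>N. \<bar>f (x [^]\<^bsub>G\<^esub> n) / real n - f x\<bar> \<le> 2 * D"
    proof (intro exI allI impI)
      fix n :: nat assume n: "n \<ge> 1"
      have "\<bar>f (x [^]\<^bsub>G\<^esub> n) - n * f x\<bar> \<le> (real n + 1) * D"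
        using almost_additive_multiple[of "\<lambda>n. f (x [^]\<^bsub>G\<^esub> n)", OF add[OF x], of n 1] x by simp
      also have "\<dots> \<le> 2 * n * D" using n D0 by (intro mult_right_mono) auto
      finally have "\<bar>f (x [^]\<^bsub>G\<^esub> n) - n * f x\<bar> / n \<le> 2 * D" using n by (simp add: field_simps)
      moreover have "f (x [^]\<^bsub>G\<^esub> n) / n - f x = (f (x [^]\<^bsub>G\<^esub> n) - n * f x) / n"
        using n by (simp add: field_simps)
      ultimately show "\<bar>f (x [^]\<^bsub>G\<^esub> n) / n - f x\<bar> \<le> 2 * D" by simp
    qed
  qed
  have pow: "r (x [^]\<^bsub>G\<^esub> k) = k * r x" if x: "x \<in> carrier G" for x and k :: nat
  proof (rule r_eqI[where C = "(real k + 1) * D"])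
    fix n :: nat
    show "\<bar>f ((x [^]\<^bsub>G\<^esub> k) [^]\<^bsub>G\<^esub> n) - k * f (x [^]\<^bsub>G\<^esub> n)\<bar> \<le> (real k + 1) * D"
      using almost_additive_multiple[of "\<lambda>n. f (x [^]\<^bsub>G\<^esub> n)", OF add[OF x], of k n] x
      by (simp add: nat_pow_pow)
  qed (use x in auto)
  have neg: "r (inv\<^bsub>G\<^esub> x) = - 1 * r x" if x: "x \<in> carrier G" for x
  proof (rule r_eqI[where C = "D + \<bar>f \<one>\<^bsub>G\<^esub>\<bar>"])
    fix n :: nat
    show "\<bar>f ((inv\<^bsub>G\<^esub> x) [^]\<^bsub>G\<^esub> n) - - 1 * f (x [^]\<^bsub>G\<^esub> n)\<bar> \<le> D + \<bar>f \<one>\<^bsub>G\<^esub>\<bar>"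
      using D[of "x [^]\<^bsub>G\<^esub> n" "inv\<^bsub>G\<^esub> (x [^]\<^bsub>G\<^esub> n)"] x by (simp add: nat_pow_inv)
  qed (use x in auto)
  have "quasi_morphism G r"
  proof (rule quasi_morphismI)
    fix x y assume "x \<in> carrier G" "y \<in> carrier G"
    then show "\<bar>r (x \<otimes>\<^bsub>G\<^esub> y) - r x - r y\<bar> \<le> 7 * D"
      using D[of x y] close[of x] close[of y] close[of "x \<otimes>\<^bsub>G\<^esub> y"] by (auto simp: abs_le_iff)
  qed
  moreover have "r (x [^]\<^bsub>G\<^esub> k) = of_int k * r x" if x: "x \<in> carrier G" for x and k :: int
  proof (cases k rule: int_cases2)
    case (nonneg n)
    then show ?thesis using pow[OF x, of n] by (simp add: int_pow_int)
  next
    case (nonpos n)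
    then show ?thesis using pow[OF x, of n] neg[of "x [^]\<^bsub>G\<^esub> n"] x
      by (simp add: int_pow_neg_int)
  qed
  ultimately have "homogeneous_quasi_morphism G r" by (simp add: homogeneous_quasi_morphism_def)
  then show ?thesis using close by (rule that)
qed

text \<open>
  Conjugating by \<open>k\<close> changes \<open>r (x ^ n)\<close> by an amount bounded independently of \<open>n\<close>, while by
  homogeneity the change is \<open>n\<close> times the change of \<open>r x\<close>.
\<close>

lemma homogeneous_quasi_morphism_conjugate:
  assumes G: "group G" and r: "homogeneous_quasi_morphism G r"
    and xy: "x \<in> carrier G" "k \<in> carrier G"
  shows "r (k \<otimes>\<^bsub>G\<^esub> x \<otimes>\<^bsub>G\<^esub> inv\<^bsub>G\<^esub> k) = r x"
proof -
  interpret group G by (rule G)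
  let ?y = "k \<otimes>\<^bsub>G\<^esub> x \<otimes>\<^bsub>G\<^esub> inv\<^bsub>G\<^esub> k"
  have hom: "r (g [^]\<^bsub>G\<^esub> n) = n * r g" if "g \<in> carrier G" for g and n :: nat
    using r that unfolding homogeneous_quasi_morphism_def int_pow_int[symmetric] by simp
  obtain D where D: "\<And>x y. x \<in> carrier G \<Longrightarrow> y \<in> carrier G \<Longrightarrow> \<bar>r (x \<otimes>\<^bsub>G\<^esub> y) - r x - r y\<bar> \<le> D"
    using r quasi_morphismE unfolding homogeneous_quasi_morphism_def by blast
  define C where "C = 2 * D + \<bar>r k\<bar> + \<bar>r (inv\<^bsub>G\<^esub> k)\<bar>"
  have bnd: "n * \<bar>r ?y - r x\<bar> \<le> C" for n :: nat
  proof -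
    have pow: "?y [^]\<^bsub>G\<^esub> n = k \<otimes>\<^bsub>G\<^esub> x [^]\<^bsub>G\<^esub> n \<otimes>\<^bsub>G\<^esub> inv\<^bsub>G\<^esub> k"
    proof (induction n)
      case (Suc n)
      have "inv\<^bsub>G\<^esub> k \<otimes>\<^bsub>G\<^esub> (k \<otimes>\<^bsub>G\<^esub> (x \<otimes>\<^bsub>G\<^esub> inv\<^bsub>G\<^esub> k)) = x \<otimes>\<^bsub>G\<^esub> inv\<^bsub>G\<^esub> k"
        using xy by (simp add: m_assoc[symmetric])
      then show ?case using Suc xy by (simp add: m_assoc)
    qed (use xy in simp)
    have "\<bar>r (?y [^]\<^bsub>G\<^esub> n) - r (x [^]\<^bsub>G\<^esub> n)\<bar> \<le> C"
      using D[of k "x [^]\<^bsub>G\<^esub> n"] D[of "k \<otimes>\<^bsub>G\<^esub> x [^]\<^bsub>G\<^esub> n" "inv\<^bsub>G\<^esub> k"] xy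
      unfolding pow C_def by (auto simp: abs_le_iff)
    then have "\<bar>n * r ?y - n * r x\<bar> \<le> C" using hom xy by simp
    then show ?thesis by (simp add: right_diff_distrib[symmetric] abs_mult)
  qed
  have "\<bar>r ?y - r x\<bar> = 0"
  proof (rule ccontr)
    assume "\<bar>r ?y - r x\<bar> \<noteq> 0"
    then have "\<bar>r ?y - r x\<bar> > 0" by simp
    from reals_Archimedean3[OF this] obtain n :: nat where "C < n * \<bar>r ?y - r x\<bar>" by blast
    with bnd[of n] show False by simp
  qed
  then show ?thesis by simp
qed

lemma homogeneous_quasi_morphism_scale:
  assumes "homogeneous_quasi_morphism G r"
  shows "homogeneous_quasi_morphism G (\<lambda>x. c * r x)"
proof -
  obtain D where D: "\<And>x y. x \<in> carrier G \<Longrightarrow> y \<in> carrier G \<Longrightarrow> \<bar>r (x \<otimes>\<^bsub>G\<^esub> y) - r x - r y\<bar> \<le> D"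
    using assms quasi_morphismE unfolding homogeneous_quasi_morphism_def by blast
  have "quasi_morphism G (\<lambda>x. c * r x)"
  proof (rule quasi_morphismI)
    fix x y assume "x \<in> carrier G" "y \<in> carrier G"
    then have "\<bar>c\<bar> * \<bar>r (x \<otimes>\<^bsub>G\<^esub> y) - r x - r y\<bar> \<le> \<bar>c\<bar> * D" using D by (simp add: mult_left_mono)
    then show "\<bar>c * r (x \<otimes>\<^bsub>G\<^esub> y) - c * r x - c * r y\<bar> \<le> \<bar>c\<bar> * D"
      by (simp add: abs_mult[symmetric] algebra_simps)
  qed
  then show ?thesis using assms by (simp add: homogeneous_quasi_morphism_def)
qed

section \<open>Counting occurrences of a word\<close>

datatype letter = S | U bool

fun letter_inv :: "letter \<Rightarrow> letter" where
  "letter_inv S = S"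
| "letter_inv (U e) = U (\<not> e)"

definition word_inv :: "letter list \<Rightarrow> letter list" where
  "word_inv v = rev (map letter_inv v)"

lemma letter_inv_inv [simp]: "letter_inv (letter_inv x) = x"
  by (cases x) auto

lemma word_inv_simps [simp]:
  "word_inv [] = []" "word_inv (x # v) = word_inv v @ [letter_inv x]"
  "word_inv (u @ v) = word_inv v @ word_inv u" "word_inv (word_inv v) = v"
  "length (word_inv v) = length v" "word_inv v = [] \<longleftrightarrow> v = []"
  by (simp_all add: word_inv_def rev_map comp_def)

text \<open>
  An occurrence is recorded by the two factors around it rather than by a position, which makes its
  behaviour under concatenation and inversion of words transparent.
\<close>

definition occurrences :: "'a list \<Rightarrow> 'a list \<Rightarrow> ('a list \<times> 'a list) set" where
  "occurrences w v = {(x, y). x @ w @ y = v}"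

lemma finite_occurrences [simp]: "finite (occurrences w v)"
proof (rule finite_subset)
  show "occurrences w v \<subseteq> (\<lambda>i. (take i v, drop (i + length w) v)) ` {..length v}"
  proof (clarify)
    fix x y assume "(x, y) \<in> occurrences w v"
    then have "v = x @ w @ y" by (simp add: occurrences_def)
    then show "(x, y) \<in> (\<lambda>i. (take i v, drop (i + length w) v)) ` {..length v}"
      by (intro image_eqI[of _ _ "length x"]) auto
  qed
qed simp

lemma occurrences_empty:
  assumes "x \<in> set w" "x \<notin> set v"
  shows "occurrences w v = {}"
  using assms by (auto simp: occurrences_def)

lemma card_occurrences_by_position:
  assumes "X \<subseteq> occurrences w v" "(\<lambda>(x, y). length x) ` X \<subseteq> I" "finite I"
  shows "card X \<le> card I"
proof (rule card_inj_on_le[OF _ assms(2,3)])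
  show "inj_on (\<lambda>(x, y). length x) X"
  proof (rule inj_onI, clarify)
    fix x y x' y' assume "(x, y) \<in> X" "(x', y') \<in> X" and len: "length x = length x'"
    then have "x @ w @ y = v" "x' @ w @ y' = v" using assms(1) by (auto simp: occurrences_def)
    then have "x @ w @ y = x' @ w @ y'" by simp
    then show "x = x' \<and> y = y'" using len by simp
  qed
qed

lemma card_occurrences_le_length:
  assumes "w \<noteq> []"
  shows "card (occurrences w v) \<le> length v"
proof -
  have "card (occurrences w v) \<le> card {..<length v}"
    by (rule card_occurrences_by_position[of _ w v]) (use assms in \<open>auto simp: occurrences_def\<close>)
  then show ?thesis by simp
qed

text \<open>
  An occurrence in \<open>u @ v\<close> lies in \<open>u\<close>, lies in \<open>v\<close>, or straddles the junction, and fewer than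
  \<open>length w\<close> positions allow the latter.
\<close>

lemma card_occurrences_append:
  assumes "w \<noteq> []"
  shows "card (occurrences w u) + card (occurrences w v) \<le> card (occurrences w (u @ v))"
    and "card (occurrences w (u @ v)) \<le> card (occurrences w u) + card (occurrences w v) + length w"
proof -
  define A where "A = (\<lambda>(x, y). (x, y @ v)) ` occurrences w u"
  define B where "B = (\<lambda>(x, y). (u @ x, y)) ` occurrences w v"
  define C where "C = {(x, y) \<in> occurrences w (u @ v). length x < length u \<and> length u < length x + length w}"
  have cA: "card A = card (occurrences w u)" unfolding A_def by (rule card_image) (auto simp: inj_on_def)
  have cB: "card B = card (occurrences w v)" unfolding B_def by (rule card_image) (auto simp: inj_on_def)
  have fin: "finite A" "finite B" unfolding A_def B_def by auto
  have disj: "A \<inter> B = {}"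
    using assms unfolding A_def B_def occurrences_def by auto
  have sub: "A \<union> B \<subseteq> occurrences w (u @ v)"
    unfolding A_def B_def occurrences_def by auto
  show "card (occurrences w u) + card (occurrences w v) \<le> card (occurrences w (u @ v))"
    using card_mono[OF _ sub] card_Un_disjoint[OF fin disj] cA cB by simp
  have cover: "occurrences w (u @ v) \<subseteq> A \<union> B \<union> C"
  proof (rule subrelI, rule ccontr)
    fix x y assume xy: "(x, y) \<in> occurrences w (u @ v)" and no: "(x, y) \<notin> A \<union> B \<union> C"
    then have eq: "x @ w @ y = u @ v" by (simp add: occurrences_def)
    consider "length x \<ge> length u" | "length x + length w \<le> length u"
      using xy no by (fastforce simp: C_def)
    then show False
    proof cases
      case 1
      then obtain z where "x = u @ z" "z @ w @ y = v"
        using eq by (auto simp: append_eq_append_conv2)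
      then have "(x, y) \<in> B" unfolding B_def occurrences_def by (auto simp: image_iff)
      then show False using no by simp
    next
      case 2
      then have "(x @ w) @ y = u @ v" "length (x @ w) \<le> length u" using eq by auto
      then obtain z where "u = (x @ w) @ z" "y = z @ v"
        by (auto simp only: append_eq_append_conv2) (auto simp: append_eq_append_conv2)
      then have "(x, y) \<in> A" unfolding A_def occurrences_def by (auto simp: image_iff)
      then show False using no by simp
    qed
  qed
  have "card C \<le> card {length u - length w..<length u}"
    by (rule card_occurrences_by_position[of _ w "u @ v"]) (auto simp: C_def)
  then have cC: "card C \<le> length w" by simp
  have "card (occurrences w (u @ v)) \<le> card (A \<union> B \<union> C)"
    using cover fin by (intro card_mono) (auto simp: C_def intro: finite_subset[OF _ finite_occurrences])
  also have "\<dots> \<le> card A + card B + card C"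
    by (meson card_Un_le le_trans add_right_mono)
  finally show "card (occurrences w (u @ v)) \<le> card (occurrences w u) + card (occurrences w v) + length w"
    using cA cB cC by simp
qed

lemma card_occurrences_word_inv:
  "card (occurrences (word_inv w) (word_inv v)) = card (occurrences w v)"
proof -
  have "bij_betw (\<lambda>(x, y). (word_inv y, word_inv x)) (occurrences w v) (occurrences (word_inv w) (word_inv v))"
  proof (rule bij_betwI[where g = "\<lambda>(x, y). (word_inv y, word_inv x)"])
    have "word_inv y @ w @ word_inv x = v" if "x @ word_inv w @ y = word_inv v" for x y
      using arg_cong[OF that, of word_inv] by simp
    then show "(\<lambda>(x, y). (word_inv y, word_inv x)) \<in> occurrences (word_inv w) (word_inv v) \<rightarrow> occurrences w v"
      by (auto simp: occurrences_def)
    show "(\<lambda>(x, y). (word_inv y, word_inv x)) \<in> occurrences w v \<rightarrow> occurrences (word_inv w) (word_inv v)"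
      by (auto simp: occurrences_def)
  qed auto
  then show ?thesis by (simp add: bij_betw_same_card)
qed

text \<open>
  The counting function of Brooks. The antisymmetry is essential: it makes the contributions of a
  segment and of its inverse cancel, which is what happens to the segment that disappears in a
  product.
\<close>

definition signed_count :: "letter list \<Rightarrow> letter list \<Rightarrow> real" where
  "signed_count w v = real (card (occurrences w v)) - real (card (occurrences (word_inv w) v))"

lemma signed_count_word_inv: "signed_count w (word_inv v) = - signed_count w v"
  using card_occurrences_word_inv[of w v] card_occurrences_word_inv[of "word_inv w" v]
  by (simp add: signed_count_def)

lemma signed_count_append:
  assumes "w \<noteq> []"
  shows "\<bar>signed_count w (u @ v) - signed_count w u - signed_count w v\<bar> \<le> length w"
proof -
  have w': "word_inv w \<noteq> []" using assms by simp
  show ?thesis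
    using card_occurrences_append[OF assms, of u v] card_occurrences_append[OF w', of u v]
    unfolding signed_count_def by (simp add: abs_le_iff)
qed

lemma abs_signed_count_le_length:
  assumes "w \<noteq> []"
  shows "\<bar>signed_count w v\<bar> \<le> length v"
proof -
  have w': "word_inv w \<noteq> []" using assms by simp
  show ?thesis
    using card_occurrences_le_length[OF assms, of v] card_occurrences_le_length[OF w', of v]
    unfolding signed_count_def by (simp add: abs_le_iff)
qed

text \<open>
  A power of \<open>w\<close> is periodic with period \<open>length w\<close>, so a window of exactly this length reads the
  letters of \<open>w\<close> cyclically.
\<close>

lemma factor_of_power_is_rotation:
  assumes "length z = length w" "p @ z @ q = concat (replicate n w)"
  shows "\<exists>x y. w = x @ y \<and> z = y @ x"
  using assms(2)
proof (induction n arbitrary: p)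
  case 0
  then show ?case using assms(1) by simp
next
  case (Suc n)
  let ?W = "concat (replicate n w)"
  have eq: "p @ z @ q = w @ ?W" using Suc.prems by simp
  show ?case
  proof (cases "length w \<le> length p")
    case True
    then obtain p' where "p' @ z @ q = ?W"
      using eq by (auto simp: append_eq_append_conv2)
    then show ?thesis by (rule Suc.IH)
  next
    case False
    then obtain t where t: "w = p @ t" "z @ q = t @ ?W"
      using eq by (auto simp: append_eq_append_conv2)
    then obtain z' where z': "z = t @ z'" "z' @ q = ?W"
      using assms(1) by (auto simp: append_eq_append_conv2)
    have len: "length z' = length p" using assms(1) t(1) z'(1) by simp
    have "z' = p"
    proof (cases n)
      case 0
      then show ?thesis using z'(2) len by simp
    next
      case (Suc m)
      then have "z' @ q = p @ (t @ concat (replicate m w))" using z'(2) t(1) by simp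
      then show ?thesis using len by simp
    qed
    then show ?thesis using t z' by blast
  qed
qed

lemma card_occurrences_power:
  assumes "w \<noteq> []"
  shows "n \<le> card (occurrences w (concat (replicate n w)))"
proof (induction n)
  case (Suc n)
  have "x = [] \<and> y = []" if "x @ w @ y = w" for x y
    using arg_cong[OF that, of length] by simp
  then have "occurrences w w = {([], [])}" by (auto simp: occurrences_def)
  then have "Suc n \<le> card (occurrences w w) + card (occurrences w (concat (replicate n w)))"
    using Suc by simp
  also have "\<dots> \<le> card (occurrences w (w @ concat (replicate n w)))"
    by (rule card_occurrences_append(1)[OF assms])
  finally show ?case by simp
qed simp

section \<open>Two by two integer matrices up to sign\<close>

definition mat2 :: "int \<Rightarrow> int \<Rightarrow> int \<Rightarrow> int \<Rightarrow> int^2^2" where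
  "mat2 a b c d = vector [vector [a, b], vector [c, d]]"

lemma mat2_simps:
  "mat2 a b c d ** mat2 a' b' c' d' =
     mat2 (a * a' + b * c') (a * b' + b * d') (c * a' + d * c') (c * b' + d * d')"
  "- mat2 a b c d = mat2 (- a) (- b) (- c) (- d)"
  "mat 1 = mat2 1 0 0 1"
  "det (mat2 a b c d) = a * d - b * c"
  "trace (mat2 a b c d) = a + d"
  "mat2 a b c d = mat2 a' b' c' d' \<longleftrightarrow> a = a' \<and> b = b' \<and> c = c' \<and> d = d'"
  by (auto simp: mat2_def det_2 trace_def vec_eq_iff forall_2 matrix_matrix_mult_def sum_2 mat_def)

lemma mat2_cases: obtains a b c d where "A = mat2 a b c d"
proof -
  have "A = mat2 (A$1$1) (A$1$2) (A$2$1) (A$2$2)"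
    by (simp add: mat2_def vec_eq_iff forall_2)
  then show ?thesis by (rule that)
qed

lemma matrix_mult_minus:
  fixes A B :: "int^2^2"
  shows "(- A) ** B = - (A ** B)" "A ** (- B) = - (A ** B)"
  by (cases A rule: mat2_cases, cases B rule: mat2_cases, simp add: mat2_simps)+

lemma det_minus_2: "det (- A) = det (A :: int^2^2)" and trace_minus: "trace (- A) = - trace (A :: int^2^2)"
  by (cases A rule: mat2_cases, simp add: mat2_simps)+

text \<open>
  Words determine matrices only in \<open>PSL(2,\<int>)\<close>, the free product of cyclic groups of orders 2 and 3.
  Working in \<open>SL(2,\<int>)\<close> with equality up to sign avoids forming the quotient.
\<close>

definition eq_up_to_sign :: "int^2^2 \<Rightarrow> int^2^2 \<Rightarrow> bool" (infix "\<simeq>" 50) where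
  "A \<simeq> B \<longleftrightarrow> A = B \<or> A = - B"

lemma eq_up_to_sign_refl [simp, intro]: "A \<simeq> A"
  and eq_up_to_sign_sym: "A \<simeq> B \<Longrightarrow> B \<simeq> A"
  and eq_up_to_sign_trans [trans]: "A \<simeq> B \<Longrightarrow> B \<simeq> C \<Longrightarrow> A \<simeq> C"
  and eq_up_to_sign_mult: "A \<simeq> A' \<Longrightarrow> B \<simeq> B' \<Longrightarrow> A ** B \<simeq> A' ** B'"
  by (auto simp: eq_up_to_sign_def matrix_mult_minus)

lemma eq_up_to_sign_abs_trace: "A \<simeq> B \<Longrightarrow> \<bar>trace A\<bar> = \<bar>trace B\<bar>"
  by (auto simp: eq_up_to_sign_def trace_minus)

text \<open>
  The adjugate, which is the inverse on matrices of determinant 1 while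
  reversing products and respecting signs on all matrices.
\<close>

definition adj2 :: "int^2^2 \<Rightarrow> int^2^2" where
  "adj2 A = mat2 (A$2$2) (- A$1$2) (- A$2$1) (A$1$1)"

lemma adj2_mat2: "adj2 (mat2 a b c d) = mat2 d (- b) (- c) a"
  by (simp add: adj2_def mat2_def)

lemma det_adj2 [simp]: "det (adj2 A) = det A" and trace_adj2: "trace (adj2 A) = trace A"
  and adj2_minus: "adj2 (- A) = - adj2 A"
  by (cases A rule: mat2_cases, simp add: adj2_mat2 mat2_simps)+

lemma adj2_one: "adj2 (mat 1) = mat 1"
  by (simp add: adj2_mat2 mat2_simps(3))

lemma adj2_inverse:
  assumes "det A = 1" shows "A ** adj2 A = mat 1" "adj2 A ** A = mat 1"
  using assms by (cases A rule: mat2_cases, simp add: adj2_mat2 mat2_simps algebra_simps)+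

lemma adj2_eq_up_to_sign: "A \<simeq> B \<Longrightarrow> adj2 A \<simeq> adj2 B"
  by (auto simp: eq_up_to_sign_def adj2_minus)

lemma adj2_mult: "adj2 (A ** B) = adj2 B ** adj2 A"
  by (cases A rule: mat2_cases, cases B rule: mat2_cases)
    (simp add: adj2_mat2 mat2_simps algebra_simps)

lemma SL2Z_simps:
  "carrier SL2Z = {A. det A = 1}" "A \<otimes>\<^bsub>SL2Z\<^esub> B = A ** B" "\<one>\<^bsub>SL2Z\<^esub> = mat 1"
  by (simp_all add: SL2Z_def)

lemma inv_SL2Z: "det A = 1 \<Longrightarrow> inv\<^bsub>SL2Z\<^esub> A = adj2 A"
  using group.inv_equality[OF group_SL2Z, of "adj2 A" A] by (simp add: SL2Z_simps adj2_inverse)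

section \<open>Words in the generators of the modular group\<close>

text \<open>
  The letter \<open>S\<close> has order 2 and the letters \<open>U True\<close> and \<open>U False\<close> are mutually inverse of order 3
  modulo sign. They are normalized so that, up to sign, \<open>S\<close> followed by \<open>U True\<close> is the upper and
  \<open>S\<close> followed by \<open>U False\<close> the lower elementary matrix with non-negative entries.
\<close>

fun letter_matrix :: "letter \<Rightarrow> int^2^2" where
  "letter_matrix S = mat2 0 (-1) 1 0"
| "letter_matrix (U e) = (if e then mat2 0 1 (-1) (-1) else mat2 (-1) (-1) 1 0)"

fun word_matrix :: "letter list \<Rightarrow> int^2^2" where
  "word_matrix [] = mat 1"
| "word_matrix (x # v) = letter_matrix x ** word_matrix v"

lemma word_matrix_append [simp]: "word_matrix (u @ v) = word_matrix u ** word_matrix v"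
  by (induction u) (simp_all add: matrix_mul_assoc)

lemma det_word_matrix [simp]: "det (word_matrix v) = 1"
proof (induction v)
  case (Cons x v)
  then show ?case by (cases x) (auto simp: det_mul mat2_simps(4))
qed simp

lemma word_matrix_power:
  "word_matrix (concat (replicate n v)) = word_matrix v [^]\<^bsub>SL2Z\<^esub> n"
proof -
  interpret group SL2Z by (rule group_SL2Z)
  show ?thesis
  proof (induction n)
    case (Suc n)
    then show ?case using nat_pow_Suc2[of "word_matrix v" n] by (simp add: SL2Z_simps)
  qed (simp add: SL2Z_simps)
qed

lemma letter_matrix_inv: "letter_matrix (letter_inv x) \<simeq> adj2 (letter_matrix x)"
  by (cases x) (auto simp: eq_up_to_sign_def adj2_mat2 mat2_simps)

lemma word_matrix_inv: "word_matrix (word_inv v) \<simeq> adj2 (word_matrix v)"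
proof (induction v)
  case Nil
  then show ?case by (simp add: adj2_mat2 mat2_simps(3))
next
  case (Cons x v)
  then show ?case by (simp add: adj2_mult eq_up_to_sign_mult letter_matrix_inv)
qed

definition alternate :: "letter \<Rightarrow> letter \<Rightarrow> bool" where
  "alternate x y \<longleftrightarrow> (x = S) \<noteq> (y = S)"

text \<open>
  These are the normal forms of the free product: no two neighbouring letters belong to the same
  cyclic factor.
\<close>

abbreviation reduced :: "letter list \<Rightarrow> bool" where
  "reduced \<equiv> successively alternate"

lemma alternate_commute: "alternate x y \<longleftrightarrow> alternate y x"
  by (auto simp: alternate_def)

lemma alternate_letter_inv: "alternate (letter_inv x) (letter_inv y) \<longleftrightarrow> alternate x y"
  by (cases x; cases y) (auto simp: alternate_def)

lemma reduced_word_inv: "reduced v \<Longrightarrow> reduced (word_inv v)"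
proof -
  assume "reduced v"
  then have "reduced (map letter_inv v)"
    by (simp add: successively_map alternate_letter_inv)
  moreover have "(\<lambda>x y. alternate y x) = alternate" by (intro ext) (rule alternate_commute)
  ultimately show ?thesis by (simp only: word_inv_def successively_rev)
qed

text \<open>
  In the Cayley graph of the free product, a tree of triangles, the points \<open>1\<close>, \<open>u\<close> and \<open>u v\<close> span a
  tripod: \<open>A\<close>, \<open>B\<close> and \<open>C\<close> spell its legs, and the words \<open>m1\<close>, \<open>m2\<close>, \<open>m3\<close> the at most one
  edge by which each side crosses the triangle in the centre.
\<close>

definition tripod where
  "tripod u v A C B m1 m2 m3 \<longleftrightarrow> u = A @ m1 @ C \<and> v = word_inv C @ m2 @ B \<and> reduced (A @ m3 @ B) \<and>
     word_matrix (A @ m3 @ B) \<simeq> word_matrix u ** word_matrix v \<and>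
     length m1 \<le> 1 \<and> length m2 \<le> 1 \<and> length m3 \<le> 1"

text \<open>
  Letters cancel at the junction of \<open>u\<close> and \<open>v\<close>, extending the leg \<open>C\<close>, until either the words
  alternate at the junction or two equal letters \<open>U e\<close> meet; the latter merge into the inverse
  letter \<open>U (\<not> e)\<close>, after which nothing cancels any more.
\<close>

lemma reduced_product:
  assumes "reduced u" "reduced v"
  shows "\<exists>A C B m1 m2 m3. tripod u v A C B m1 m2 m3"
  using assms
proof (induction u arbitrary: v rule: rev_induct)
  case Nil
  then have "tripod [] v [] [] v [] [] []" by (simp add: tripod_def)
  then show ?case by blast
next
  case (snoc x u)
  consider "v = []" | y v' where "v = y # v'" "alternate x y"
    | y v' where "v = y # v'" "y = letter_inv x"
    | e v' where "v = U e # v'" "x = U e"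
    by (cases v; cases x; cases "hd v") (auto simp: alternate_def)
  then show ?case
  proof cases
    case 1
    then have "tripod (u @ [x]) v (u @ [x]) [] [] [] [] []"
      using snoc.prems by (simp add: tripod_def)
    then show ?thesis by blast
  next
    case (2 y v')
    then have "tripod (u @ [x]) v (u @ [x]) [] v [] [] []"
      using snoc.prems by (simp add: tripod_def successively_append_iff successively_Cons matrix_mul_assoc)
    then show ?thesis by blast
  next
    case (3 y v')
    have "reduced u" "reduced v'"
      using snoc.prems 3 by (auto simp: successively_append_iff successively_Cons)
    from snoc.IH[OF this] obtain A C B m1 m2 m3 where IH: "tripod u v' A C B m1 m2 m3"
      by blast
    have "letter_matrix x ** letter_matrix y \<simeq> mat 1"
      using 3 by (cases x) (auto simp: eq_up_to_sign_def mat2_simps)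
    from eq_up_to_sign_mult[OF eq_up_to_sign_mult[OF eq_up_to_sign_refl this] eq_up_to_sign_refl,
        of "word_matrix u" "word_matrix v'"]
    have "word_matrix u ** word_matrix v' \<simeq> word_matrix (u @ [x]) ** word_matrix v"
      using 3 eq_up_to_sign_sym by (simp add: matrix_mul_assoc)
    then have "word_matrix (A @ m3 @ B) \<simeq> word_matrix (u @ [x]) ** word_matrix v"
      using IH eq_up_to_sign_trans unfolding tripod_def by blast
    then have "tripod (u @ [x]) v A (C @ [x]) B m1 m2 m3"
      using IH 3 by (simp add: tripod_def matrix_mul_assoc)
    then show ?thesis by blast
  next
    case (4 e v')
    have "letter_matrix (U (\<not> e)) = letter_matrix (U e) ** letter_matrix (U e)"
      by (simp add: mat2_simps)
    then have "word_matrix (u @ [U (\<not> e)] @ v') = word_matrix (u @ [x]) ** word_matrix v"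
      using 4 by (simp add: matrix_mul_assoc del: letter_matrix.simps)
    moreover have "reduced (u @ [U (\<not> e)] @ v')"
      using snoc.prems 4 by (auto simp: successively_append_iff successively_Cons alternate_def)
    ultimately have "tripod (u @ [x]) v u [] v' [U e] [U e] [U (\<not> e)]"
      using 4 by (simp add: tripod_def)
    then show ?thesis by blast
  qed
qed

text \<open>
  Along the legs of the tripod, \<open>A\<close> and \<open>B\<close> contribute equally to both sides, and the
  contributions of \<open>C\<close> and of its inverse cancel. Only the centre and the junctions remain.
\<close>

corollary reduced_product_signed_count:
  assumes "reduced u" "reduced v" "w \<noteq> []"
  obtains z where "reduced z" "word_matrix z \<simeq> word_matrix u ** word_matrix v"
    "\<bar>signed_count w z - signed_count w u - signed_count w v\<bar> \<le> 6 * length w + 3"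
proof -
  obtain A C B m1 m2 m3 where *: "u = A @ m1 @ C" "v = word_inv C @ m2 @ B" "reduced (A @ m3 @ B)"
    "word_matrix (A @ m3 @ B) \<simeq> word_matrix u ** word_matrix v"
    "length m1 \<le> 1" "length m2 \<le> 1" "length m3 \<le> 1"
    using reduced_product[OF assms(1,2)] unfolding tripod_def by blast
  have piece: "\<bar>signed_count w (X @ m @ Y) - signed_count w X - signed_count w Y\<bar> \<le> 2 * length w + 1"
    if "length m \<le> 1" for X m Y
    using signed_count_append[OF assms(3), of X "m @ Y"] signed_count_append[OF assms(3), of m Y]
      abs_signed_count_le_length[OF assms(3), of m] that by linarith
  have "\<bar>signed_count w (A @ m3 @ B) - signed_count w u - signed_count w v\<bar> \<le> 6 * length w + 3"
    using piece[OF *(5), of A C] piece[OF *(6), of "word_inv C" B] piece[OF *(7), of A B]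
    unfolding *(1,2) signed_count_word_inv by linarith
  then show ?thesis using that *(3,4) by blast
qed

text \<open>
  Up to sign, the value of such a word is a product of the two elementary matrices with non-negative
  entries: \<open>True\<close> stands for the upper and \<open>False\<close> for the lower one.
\<close>

definition positive_word :: "bool list \<Rightarrow> letter list" where
  "positive_word es = concat (map (\<lambda>e. [S, U e]) es)"

lemma positive_word_simps [simp]:
  "positive_word [] = []" "positive_word (e # es) = S # U e # positive_word es"
  "positive_word (es @ es') = positive_word es @ positive_word es'"
  "positive_word es = [] \<longleftrightarrow> es = []"
  by (cases es; simp add: positive_word_def)+

lemma concat_replicate_positive_word:
  "concat (replicate n (positive_word es)) = positive_word (concat (replicate n es))"
  by (induction n) auto

lemma set_positive_word: "U e \<in> set (positive_word es) \<longleftrightarrow> e \<in> set es"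
  by (induction es) auto

lemma reduced_positive_word: "reduced (positive_word es)"
proof (induction es)
  case (Cons e es)
  then show ?case by (cases es) (auto simp: alternate_def)
qed simp

lemma reduced_decomposition:
  assumes "reduced v"
  shows "\<exists>p es q. v = p @ positive_word es @ q \<and> (p = [] \<or> (\<exists>e. p = [U e])) \<and> (q = [] \<or> q = [S])"
  using assms
proof (induction v)
  case (Cons x v)
  then obtain p es q where IH: "v = p @ positive_word es @ q" "p = [] \<or> (\<exists>e. p = [U e])" "q = [] \<or> q = [S]"
    by (auto simp: successively_Cons)
  show ?case
  proof (cases x)
    case S
    show ?thesis
    proof (cases p)
      case Nil
      have "es = []" using Cons.prems IH S Nil by (cases es) (auto simp: alternate_def)
      moreover have "q = []" using Cons.prems IH S Nil \<open>es = []\<close> by (auto simp: alternate_def)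
      ultimately show ?thesis using IH S Nil
        by - (rule exI[of _ "[]"], rule exI[of _ "[]"], rule exI[of _ "[S]"], auto)
    next
      case (Cons y p')
      then obtain e where "p = [U e]" using IH by auto
      then show ?thesis using IH S
        by - (rule exI[of _ "[]"], rule exI[of _ "e # es"], rule exI[of _ q], auto)
    qed
  next
    case (U e)
    then have "p = []" using Cons.prems IH by (auto simp: alternate_def successively_Cons)
    then show ?thesis using IH U by - (rule exI[of _ "[U e]"], rule exI[of _ es], rule exI[of _ q], auto)
  qed
qed (rule exI[of _ "[]"], simp)

text \<open>
  There is no cancellation in a product of non-negative matrices, so an off-diagonal entry becomes
  positive with the first elementary factor of its kind and remains so.
\<close>

lemma positive_word_matrix:
  "\<exists>a b c d. word_matrix (positive_word es) \<simeq> mat2 a b c d \<and> a \<ge> 1 \<and> b \<ge> 0 \<and> c \<ge> 0 \<and> d \<ge> 1 \<and>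
     (b > 0 \<longleftrightarrow> True \<in> set es) \<and> (c > 0 \<longleftrightarrow> False \<in> set es)"
proof (induction es)
  case Nil
  then show ?case by - (rule exI[of _ 1], rule exI[of _ 0], rule exI[of _ 0], rule exI[of _ 1], auto simp: mat2_simps)
next
  case (Cons e es)
  then obtain a b c d where IH: "word_matrix (positive_word es) \<simeq> mat2 a b c d" "a \<ge> 1" "b \<ge> 0" "c \<ge> 0" "d \<ge> 1"
     "b > 0 \<longleftrightarrow> True \<in> set es" "c > 0 \<longleftrightarrow> False \<in> set es" by blast
  let ?T = "if e then mat2 1 1 0 1 else mat2 1 0 1 1"
  have "letter_matrix S ** letter_matrix (U e) \<simeq> ?T"
    by (auto simp: eq_up_to_sign_def mat2_simps)
  from eq_up_to_sign_mult[OF this IH(1)]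
  have step: "word_matrix (positive_word (e # es)) \<simeq> ?T ** mat2 a b c d"
    by (simp add: matrix_mul_assoc)
  then show ?case
  proof (cases e)
    case True
    with step IH show ?thesis
      by - (rule exI[of _ "a + c"], rule exI[of _ "b + d"], rule exI[of _ c], rule exI[of _ d], auto simp: mat2_simps)
  next
    case False
    with step IH show ?thesis
      by - (rule exI[of _ a], rule exI[of _ b], rule exI[of _ "a + c"], rule exI[of _ "b + d"], auto simp: mat2_simps)
  qed
qed

text \<open>
  For a non-negative matrix of determinant 1 with positive diagonal, \<open>a * d = 1 + b * c\<close> exceeds 1
  exactly if both off-diagonal entries are positive.
\<close>

lemma positive_word_hyperbolic_iff:
  "\<bar>trace (word_matrix (positive_word es))\<bar> > 2 \<longleftrightarrow> True \<in> set es \<and> False \<in> set es"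
proof -
  obtain a b c d where m: "word_matrix (positive_word es) \<simeq> mat2 a b c d" "a \<ge> 1" "b \<ge> 0" "c \<ge> 0" "d \<ge> 1"
     "b > 0 \<longleftrightarrow> True \<in> set es" "c > 0 \<longleftrightarrow> False \<in> set es" using positive_word_matrix by blast
  have "det (mat2 a b c d) = 1"
    using m(1) det_word_matrix[of "positive_word es"] by (metis eq_up_to_sign_def det_minus_2)
  then have det: "a * d = 1 + b * c" by (simp add: mat2_simps)
  have tr: "\<bar>trace (word_matrix (positive_word es))\<bar> = a + d"
    using eq_up_to_sign_abs_trace[OF m(1)] m by (simp add: mat2_simps)
  have "a + d > 2 \<longleftrightarrow> b > 0 \<and> c > 0"
  proof
    assume "a + d > 2"
    then have "a * d \<noteq> 1" by (auto simp: zmult_eq_1_iff)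
    then have "b * c \<noteq> 0" using det by simp
    then show "b > 0 \<and> c > 0" using m by auto
  next
    assume "b > 0 \<and> c > 0"
    then have "a * d \<noteq> 1" using det by simp
    then have "a \<noteq> 1 \<or> d \<noteq> 1" by auto
    then show "a + d > 2" using m by auto
  qed
  then show ?thesis using tr m by simp
qed

text \<open>
  Ping-pong: if \<open>p P q = \<plusminus>1\<close> with \<open>P\<close> non-negative and with positive diagonal, then \<open>P\<close> is, up to
  sign, the inverse of the short word \<open>q p\<close>; among these inverses only the identity has this form.
\<close>

lemma reduced_trivial:
  assumes "reduced v" "word_matrix v \<simeq> mat 1"
  shows "v = []"
proof -
  obtain p es q where v: "v = p @ positive_word es @ q" "p = [] \<or> (\<exists>e. p = [U e])" "q = [] \<or> q = [S]"
    using reduced_decomposition[OF assms(1)] by blast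
  obtain a b c d where m: "word_matrix (positive_word es) \<simeq> mat2 a b c d" "a \<ge> 1" "b \<ge> 0" "c \<ge> 0" "d \<ge> 1"
     "b > 0 \<longleftrightarrow> True \<in> set es" "c > 0 \<longleftrightarrow> False \<in> set es" using positive_word_matrix by blast
  have "word_matrix p ** mat2 a b c d ** word_matrix q \<simeq> mat 1"
    using eq_up_to_sign_mult[OF eq_up_to_sign_mult[OF eq_up_to_sign_refl m(1)] eq_up_to_sign_refl,
        of "word_matrix p" "word_matrix q"] assms(2) v(1)
    by (simp add: matrix_mul_assoc) (meson eq_up_to_sign_sym eq_up_to_sign_trans)
  then have "p = [] \<and> q = [] \<and> b = 0 \<and> c = 0"
    using v(2,3) m(2-5) by (auto simp: eq_up_to_sign_def mat2_simps split: if_splits)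
  then have "True \<notin> set es" "False \<notin> set es" using m by auto
  then have "es = []" by (metis (full_types) ex_in_conv set_empty2)
  then show ?thesis using v(1) \<open>p = [] \<and> _\<close> by simp
qed

section \<open>Every matrix is the value of a reduced word\<close>

definition has_reduced_word :: "int^2^2 \<Rightarrow> bool" where
  "has_reduced_word g \<longleftrightarrow> (\<exists>v. reduced v \<and> word_matrix v \<simeq> g)"

lemma has_reduced_word_mult: "has_reduced_word g \<Longrightarrow> has_reduced_word h \<Longrightarrow> has_reduced_word (g ** h)"
  proof -
  assume "has_reduced_word g" "has_reduced_word h"
  then obtain u v where uv: "reduced u" "word_matrix u \<simeq> g" "reduced v" "word_matrix v \<simeq> h"
    by (auto simp: has_reduced_word_def)
  obtain z where "reduced z" "word_matrix z \<simeq> word_matrix u ** word_matrix v"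
    using reduced_product[OF uv(1,3)] unfolding tripod_def by blast
  then show ?thesis
    unfolding has_reduced_word_def using eq_up_to_sign_mult[OF uv(2,4)] eq_up_to_sign_trans by blast
qed

lemma has_reduced_word_generators:
  "has_reduced_word (mat2 0 (-1) 1 0)" "has_reduced_word (mat2 1 1 0 1)" "has_reduced_word (mat2 1 0 1 1)"
  "has_reduced_word (mat2 1 (-1) 0 1)" "has_reduced_word (mat2 1 0 (-1) 1)"
proof -
  have *: "has_reduced_word g" if "reduced v" "word_matrix v \<simeq> g" for v g
    using that by (auto simp: has_reduced_word_def)
  show "has_reduced_word (mat2 0 (-1) 1 0)" by (rule *[of "[S]"]) (auto simp: eq_up_to_sign_def mat2_simps)
  show "has_reduced_word (mat2 1 1 0 1)" by (rule *[of "[S, U True]"]) (auto simp: eq_up_to_sign_def mat2_simps alternate_def)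
  show "has_reduced_word (mat2 1 0 1 1)" by (rule *[of "[S, U False]"]) (auto simp: eq_up_to_sign_def mat2_simps alternate_def)
  show "has_reduced_word (mat2 1 (-1) 0 1)" by (rule *[of "[U False, S]"]) (auto simp: eq_up_to_sign_def mat2_simps alternate_def)
  show "has_reduced_word (mat2 1 0 (-1) 1)" by (rule *[of "[U True, S]"]) (auto simp: eq_up_to_sign_def mat2_simps alternate_def)
qed

lemma has_reduced_word_cong: "has_reduced_word g \<Longrightarrow> g \<simeq> h \<Longrightarrow> has_reduced_word h"
  unfolding has_reduced_word_def using eq_up_to_sign_trans by blast

lemma has_reduced_word_unipotent: "has_reduced_word (mat2 1 b 0 1)"
proof (induction b rule: int_induct[where k = 0])
  case base
  have "has_reduced_word (mat 1)" unfolding has_reduced_word_def by - (rule exI[of _ "[]"], simp)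
  then show ?case by (simp add: mat2_simps)
next
  case (step1 b)
  then show ?case using has_reduced_word_mult[OF has_reduced_word_generators(2) step1(2)] by (simp add: mat2_simps)
next
  case (step2 b)
  then show ?case using has_reduced_word_mult[OF has_reduced_word_generators(4) step2(2)] by (simp add: mat2_simps)
qed

text \<open>
  The Euclidean algorithm on the first column: elementary row operations lower
  \<open>\<bar>a\<bar> + \<bar>c\<bar>\<close> until one of the two entries vanishes.
\<close>

lemma has_reduced_word_if_det_1:
  assumes "det g = 1"
  shows "has_reduced_word g"
proof -
  have upper: "has_reduced_word (mat2 a b 0 d)" if "a * d = 1" for a b d
  proof -
    have "(a = 1 \<and> d = 1) \<or> (a = -1 \<and> d = -1)" using that by (auto simp: zmult_eq_1_iff)
    then show ?thesis
      using has_reduced_word_unipotent[of b] has_reduced_word_cong[OF has_reduced_word_unipotent[of "- b"], of "mat2 a b 0 d"]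
      by (auto simp: eq_up_to_sign_def mat2_simps)
  qed
  have "has_reduced_word (mat2 a b c d)" if "a * d - b * c = 1" for a b c d
    using that
  proof (induction "nat (\<bar>a\<bar> + \<bar>c\<bar>)" arbitrary: a b c d rule: less_induct)
    case less
    have IH: "has_reduced_word (mat2 a' b' c' d')"
      if "\<bar>a'\<bar> + \<bar>c'\<bar> < \<bar>a\<bar> + \<bar>c\<bar>" "a' * d' - b' * c' = 1" for a' b' c' d'
      using less.hyps[of a' c' d' b'] that by simp
    note gens = has_reduced_word_generators
    (* Adding or subtracting the entry of smaller absolute value reduces the other one. *)
    consider "c = 0" | "a = 0" | "a \<noteq> 0" "c \<noteq> 0" "\<bar>a - c\<bar> < \<bar>a\<bar>" | "a \<noteq> 0" "c \<noteq> 0" "\<bar>a + c\<bar> < \<bar>a\<bar>"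
      | "a \<noteq> 0" "c \<noteq> 0" "\<bar>c - a\<bar> < \<bar>c\<bar>" | "a \<noteq> 0" "c \<noteq> 0" "\<bar>c + a\<bar> < \<bar>c\<bar>"
      by linarith
    then show ?case
    proof cases
      case 1
      then show ?thesis using upper less.prems by simp
    next
      case 2
      have "has_reduced_word (mat2 c d (- a) (- b))" using upper[of c "- b" d] 2 less.prems by (simp add: mult.commute)
      from has_reduced_word_mult[OF gens(1) this] show ?thesis by (simp add: mat2_simps)
    next
      case 3
      have "has_reduced_word (mat2 (a - c) (b - d) c d)"
        by (rule IH) (use 3 less.prems in \<open>auto simp: algebra_simps\<close>)
      from has_reduced_word_mult[OF gens(2) this] show ?thesis by (simp add: mat2_simps)
    next
      case 4
      have "has_reduced_word (mat2 (a + c) (b + d) c d)"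
        by (rule IH) (use 4 less.prems in \<open>auto simp: algebra_simps\<close>)
      from has_reduced_word_mult[OF gens(4) this] show ?thesis by (simp add: mat2_simps)
    next
      case 5
      have "has_reduced_word (mat2 a b (c - a) (d - b))"
        by (rule IH) (use 5 less.prems in \<open>auto simp: algebra_simps\<close>)
      from has_reduced_word_mult[OF gens(3) this] show ?thesis by (simp add: mat2_simps)
    next
      case 6
      have "has_reduced_word (mat2 a b (c + a) (d + b))"
        by (rule IH) (use 6 less.prems in \<open>auto simp: algebra_simps\<close>)
      from has_reduced_word_mult[OF gens(5) this] show ?thesis by (simp add: mat2_simps)
    qed
  qed
  then show ?thesis using assms by (cases g rule: mat2_cases) (simp add: mat2_simps)
qed

section \<open>Counting quasi-morphisms\<close>

text \<open>
  The reduced word of a matrix is unique, but for a quasi-morphism it suffices that the count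
  depends on the chosen word only up to a constant, so an arbitrary choice is made.
\<close>

definition counting_function :: "letter list \<Rightarrow> int^2^2 \<Rightarrow> real" where
  "counting_function w g = signed_count w (SOME v. reduced v \<and> word_matrix v \<simeq> g)"

text \<open>
  If \<open>u\<close> and \<open>v\<close> are reduced words of the same element, the reduced product of the inverse of \<open>v\<close>
  with \<open>u\<close> is trivial and hence empty, so their counts differ by at most the defect of
  \<open>signed_count\<close>.
\<close>

lemma counting_function_approx:
  assumes "w \<noteq> []" "reduced v" "word_matrix v \<simeq> g"
  shows "\<bar>counting_function w g - signed_count w v\<bar> \<le> 6 * length w + 3"
proof -
  define u where "u = (SOME v. reduced v \<and> word_matrix v \<simeq> g)"
  have u: "reduced u" "word_matrix u \<simeq> g"
    using someI[of "\<lambda>v. reduced v \<and> word_matrix v \<simeq> g" v] assms(2,3) by (auto simp: u_def)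
  obtain z where z: "reduced z" "word_matrix z \<simeq> word_matrix (word_inv v) ** word_matrix u"
    "\<bar>signed_count w z - signed_count w (word_inv v) - signed_count w u\<bar> \<le> 6 * length w + 3"
    using reduced_product_signed_count[OF reduced_word_inv[OF assms(2)] u(1) assms(1)] .
  have "word_matrix u \<simeq> word_matrix v" using u(2) assms(3) eq_up_to_sign_sym eq_up_to_sign_trans by blast
  note z(2)
  also have "word_matrix (word_inv v) ** word_matrix u \<simeq> adj2 (word_matrix v) ** word_matrix v"
    using word_matrix_inv \<open>word_matrix u \<simeq> word_matrix v\<close> by (rule eq_up_to_sign_mult)
  finally have "z = []" using z(1) by (simp add: adj2_inverse reduced_trivial)
  moreover have "signed_count w [] = 0" using abs_signed_count_le_length[OF assms(1), of "[]"] by simp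
  ultimately show ?thesis
    using z(3) by (simp add: signed_count_word_inv counting_function_def flip: u_def)
qed

lemma counting_function_defect:
  assumes "w \<noteq> []" "det g = 1" "det h = 1"
  shows "\<bar>counting_function w (g ** h) - counting_function w g - counting_function w h\<bar> \<le> 24 * length w + 12"
proof -
  obtain u where u: "reduced u" "word_matrix u \<simeq> g"
    using has_reduced_word_if_det_1[OF assms(2)] unfolding has_reduced_word_def by blast
  obtain v where v: "reduced v" "word_matrix v \<simeq> h"
    using has_reduced_word_if_det_1[OF assms(3)] unfolding has_reduced_word_def by blast
  obtain z where z: "reduced z" "word_matrix z \<simeq> word_matrix u ** word_matrix v"
    "\<bar>signed_count w z - signed_count w u - signed_count w v\<bar> \<le> 6 * length w + 3"
    using reduced_product_signed_count[OF u(1) v(1) assms(1)] .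
  have "word_matrix z \<simeq> g ** h"
    using eq_up_to_sign_trans[OF z(2) eq_up_to_sign_mult[OF u(2) v(2)]] .
  from counting_function_approx[OF assms(1) z(1) this] counting_function_approx[OF assms(1) u]
    counting_function_approx[OF assms(1) v] z(3)
  show ?thesis by linarith
qed

section \<open>Conjugacy\<close>

definition conjugate_up_to_sign :: "int^2^2 \<Rightarrow> int^2^2 \<Rightarrow> bool" where
  "conjugate_up_to_sign A B \<longleftrightarrow> (\<exists>k. det k = 1 \<and> k ** A ** adj2 k \<simeq> B)"

lemma conjugate_up_to_signI: "A \<simeq> B \<Longrightarrow> conjugate_up_to_sign A B"
  unfolding conjugate_up_to_sign_def
  by (intro exI[of _ "mat 1"]) (simp add: adj2_one)

lemma adj2_adj2: "adj2 (adj2 A) = A"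
  by (cases A rule: mat2_cases) (simp add: adj2_mat2)

lemma conjugate_up_to_sign_trans [trans]:
  assumes "conjugate_up_to_sign A B" "conjugate_up_to_sign B C"
  shows "conjugate_up_to_sign A C"
proof -
  obtain k l where k: "det k = 1" "k ** A ** adj2 k \<simeq> B" and l: "det l = 1" "l ** B ** adj2 l \<simeq> C"
    using assms unfolding conjugate_up_to_sign_def by blast
  have "l ** (k ** A ** adj2 k) ** adj2 l \<simeq> l ** B ** adj2 l"
    by (intro eq_up_to_sign_mult k) auto
  then have "(l ** k) ** A ** adj2 (l ** k) \<simeq> C"
    using eq_up_to_sign_trans[OF _ l(2)] by (simp add: adj2_mult matrix_mul_assoc)
  then show ?thesis unfolding conjugate_up_to_sign_def
    using k l by (intro exI[of _ "l ** k"]) (simp add: det_mul)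
qed

lemma conjugate_up_to_sign_sym:
  assumes "conjugate_up_to_sign A B"
  shows "conjugate_up_to_sign B A"
proof -
  obtain k where k: "det k = 1" "k ** A ** adj2 k \<simeq> B"
    using assms unfolding conjugate_up_to_sign_def by blast
  have "adj2 k ** B ** k \<simeq> adj2 k ** (k ** A ** adj2 k) ** k"
    by (intro eq_up_to_sign_mult k(2)[THEN eq_up_to_sign_sym]) auto
  also have "adj2 k ** (k ** A ** adj2 k) ** k = (adj2 k ** k) ** A ** (adj2 k ** k)"
    by (simp add: matrix_mul_assoc)
  also have "\<dots> = A" using k(1) by (simp add: adj2_inverse)
  finally show ?thesis unfolding conjugate_up_to_sign_def
    using k(1) by (intro exI[of _ "adj2 k"]) (simp add: adj2_adj2)
qed

lemma conjugate_up_to_sign_adj2: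
  assumes "conjugate_up_to_sign A B"
  shows "conjugate_up_to_sign (adj2 A) (adj2 B)"
proof -
  obtain k where k: "det k = 1" "k ** A ** adj2 k \<simeq> B"
    using assms unfolding conjugate_up_to_sign_def by blast
  then show ?thesis unfolding conjugate_up_to_sign_def
    using adj2_eq_up_to_sign[OF k(2)] by (intro exI[of _ k]) (simp add: adj2_mult adj2_adj2 matrix_mul_assoc)
qed

lemma trace_conjugate: "det k = 1 \<Longrightarrow> trace (k ** A ** adj2 k) = trace A"
  using trace_mul_sym[of "k ** A" "adj2 k"] by (simp add: matrix_mul_assoc adj2_inverse)

lemma conjugate_up_to_sign_abs_trace:
  "conjugate_up_to_sign A B \<Longrightarrow> \<bar>trace A\<bar> = \<bar>trace B\<bar>"
  unfolding conjugate_up_to_sign_def using eq_up_to_sign_abs_trace trace_conjugate by metis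

lemma conjugate_up_to_sign_rotate:
  "conjugate_up_to_sign (word_matrix (u @ v)) (word_matrix (v @ u))"
proof -
  have "word_matrix v ** word_matrix (u @ v) ** adj2 (word_matrix v) =
      word_matrix v ** word_matrix u ** (word_matrix v ** adj2 (word_matrix v))"
    by (simp add: matrix_mul_assoc)
  then show ?thesis unfolding conjugate_up_to_sign_def
    by (intro exI[of _ "word_matrix v"]) (simp add: adj2_inverse)
qed

lemma reduced_is_positive_word:
  assumes "reduced v" "v \<noteq> []" "hd v = S" "last v \<noteq> S"
  shows "\<exists>es. v = positive_word es"
  using reduced_decomposition[OF assms(1)] assms(2-4) by auto

text \<open>
  Cyclic reduction: as long as the last and the first letter belong to the same cyclic factor,
  rotating the word and merging them shortens it. A word of length at least 2 that cannot be
  shortened in this way alternates cyclically, so it or a rotation of it begins with \<open>S\<close> and ends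
  with some \<open>U e\<close>.
\<close>

lemma cyclic_reduction:
  assumes "reduced v"
  shows "\<exists>v'. conjugate_up_to_sign (word_matrix v) (word_matrix v') \<and>
    (length v' \<le> 1 \<or> (\<exists>es. v' = positive_word es))"
  using assms
proof (induction v rule: length_induct)
  case (1 v)
  have shorter: ?case
    if "conjugate_up_to_sign (word_matrix v) (word_matrix u)" "reduced u" "length u < length v" for u
    using 1 that conjugate_up_to_sign_trans by blast
  show ?case
  proof (cases "length v \<le> 1")
    case True
    then show ?thesis using conjugate_up_to_signI[OF eq_up_to_sign_refl] by blast
  next
    case False
    then obtain x t y where v: "v = x # t @ [y]"
      by (cases v; cases "tl v" rule: rev_cases) auto
    have red: "reduced t" "reduced (x # t)" "reduced (t @ [y])"
      using successively_append_iff[of alternate "x # t" "[y]"]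
        successively_append_iff[of alternate "[x]" "t @ [y]"] successively_append_iff[of alternate t "[y]"]
        1(2) unfolding v by simp_all
    have rot: "conjugate_up_to_sign (word_matrix v) (word_matrix (t @ [y, x]))"
      using conjugate_up_to_sign_rotate[of "[x]" "t @ [y]"] by (simp add: v)
    have merge: "conjugate_up_to_sign (word_matrix v) (word_matrix (t @ m))"
      if "letter_matrix y ** letter_matrix x \<simeq> word_matrix m" for m
    proof -
      have "word_matrix (t @ [y, x]) \<simeq> word_matrix (t @ m)"
        using eq_up_to_sign_mult[OF eq_up_to_sign_refl that, of "word_matrix t"]
        by (simp add: matrix_mul_assoc)
      from conjugate_up_to_sign_trans[OF rot conjugate_up_to_signI[OF this]] show ?thesis .
    qed
    consider "x = S" "y \<noteq> S" | e where "x = U e" "y = S" | "y = letter_inv x" | e where "x = U e" "y = U e"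
      by (cases x; cases y) auto
    then show ?thesis
    proof cases
      case 1
      then obtain es where "v = positive_word es"
        using reduced_is_positive_word[of v] \<open>reduced v\<close> v by auto
      then show ?thesis using conjugate_up_to_signI[OF eq_up_to_sign_refl] by blast
    next
      case (2 e)
      have "reduced (S # x # t)" using red(2) 2 by (simp add: alternate_def)
      moreover have "last (x # t) \<noteq> S"
        using red(3) 2 by (auto simp: successively_append_iff alternate_def)
      ultimately obtain es where "S # x # t = positive_word es"
        using reduced_is_positive_word[of "S # x # t"] by auto
      then show ?thesis
        using conjugate_up_to_sign_rotate[of "x # t" "[y]"] 2 v by (metis append_Cons append_Nil)
    next
      case 3
      have "letter_matrix y ** letter_matrix x \<simeq> word_matrix []"
        unfolding 3 by (cases x) (auto simp: eq_up_to_sign_def mat2_simps)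
      from merge[OF this] show ?thesis using shorter[of t] red(1) v by simp
    next
      case (4 e)
      have "letter_matrix y ** letter_matrix x \<simeq> word_matrix [U (\<not> e)]"
        unfolding 4 by (auto simp: eq_up_to_sign_def mat2_simps)
      from merge[OF this] show ?thesis
        using shorter[of "t @ [U (\<not> e)]"] red(3) 4 v by (auto simp: successively_append_iff alternate_def)
    qed
  qed
qed

text \<open>
  The words of one letter are excluded because they have trace 0 or \<open>-1\<close>.
\<close>

lemma conjugate_to_positive_word:
  assumes "det g = 1" "\<bar>trace g\<bar> \<ge> 2"
  obtains es where "conjugate_up_to_sign g (word_matrix (positive_word es))"
proof -
  obtain v where v: "reduced v" "word_matrix v \<simeq> g"
    using has_reduced_word_if_det_1[OF assms(1)] unfolding has_reduced_word_def by blast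
  obtain v' where v': "conjugate_up_to_sign (word_matrix v) (word_matrix v')"
    "length v' \<le> 1 \<or> (\<exists>es. v' = positive_word es)"
    using cyclic_reduction[OF v(1)] by blast
  have conj: "conjugate_up_to_sign g (word_matrix v')"
    using conjugate_up_to_sign_trans[OF conjugate_up_to_signI v'(1)] eq_up_to_sign_sym[OF v(2)] by blast
  have "\<bar>trace (letter_matrix x)\<bar> \<le> 1" for x
    by (cases x) (auto simp: mat2_simps)
  then have "\<bar>trace (word_matrix [x])\<bar> \<le> 1" for x by simp
  then have "v' \<noteq> [x]" for x
    using conjugate_up_to_sign_abs_trace[OF conj] assms(2) by (metis numeral_le_one_iff order_trans semiring_norm(69))
  then have "\<exists>es. v' = positive_word es"
    using v'(2) by (cases v'; cases "tl v'") (auto intro: exI[of _ "[]"])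
  then show ?thesis using conj that by blast
qed

text \<open>
  A matrix of determinant 1 has the same trace as its inverse, so a non-zero trace
  determines the sign.
\<close>

lemma conjugate_up_to_sign_inverse:
  assumes "det h = 1" "trace h \<noteq> 0" "conjugate_up_to_sign h (adj2 h)"
  shows "conjugate_in SL2Z h (inv\<^bsub>SL2Z\<^esub> h)"
proof -
  obtain k where k: "det k = 1" "k ** h ** adj2 k \<simeq> adj2 h"
    using assms(3) unfolding conjugate_up_to_sign_def by blast
  have "trace (k ** h ** adj2 k) \<noteq> trace (- adj2 h)"
    using assms(2) k(1) by (simp add: trace_conjugate trace_minus trace_adj2)
  then have "k ** h ** adj2 k = adj2 h" using k(2) by (auto simp: eq_up_to_sign_def)
  then show ?thesis
    unfolding conjugate_in_def using k(1) assms(1) by (auto simp: SL2Z_simps inv_SL2Z)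
qed

text \<open>
  Besides being conjugation invariant, \<open>r\<close> does not see the sign, because a matrix and its negative
  have the same square.
\<close>

lemma homogeneous_conjugate_up_to_sign:
  assumes r: "homogeneous_quasi_morphism SL2Z r" and "conjugate_up_to_sign A B" "det A = 1"
  shows "r A = r B"
proof -
  have minus: "r (- C) = r C" if "det C = 1" for C
  proof -
    have "r (C [^]\<^bsub>SL2Z\<^esub> (2::int)) = 2 * r C" if "det C = 1" for C
      using r that by (auto simp: homogeneous_quasi_morphism_def SL2Z_simps)
    moreover have "C [^]\<^bsub>SL2Z\<^esub> (2::int) = C ** C" if "det C = 1" for C
      using int_pow_int[where G = SL2Z and x = C and n = 2] that
      by (simp add: numeral_2_eq_2 SL2Z_simps)
    ultimately have "2 * r (- C) = 2 * r C"
      using that by (metis det_minus_2 matrix_mult_minus minus_minus)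
    then show ?thesis by simp
  qed
  obtain k where k: "det k = 1" "k ** A ** adj2 k \<simeq> B"
    using assms(2) unfolding conjugate_up_to_sign_def by blast
  have "r A = r (k ** A ** adj2 k)"
    using homogeneous_quasi_morphism_conjugate[OF group_SL2Z r, of A k] k(1) assms(3)
    by (simp add: SL2Z_simps inv_SL2Z)
  also have "det (k ** A ** adj2 k) = 1" using k(1) assms(3) by (simp add: det_mul)
  then have "r (k ** A ** adj2 k) = r B"
    using k(2) minus by (auto simp: eq_up_to_sign_def det_minus_2)
  finally show ?thesis .
qed

section \<open>Separating a hyperbolic element from its inverse\<close>

text \<open>
  Powers of positive words are again reduced words, so on them the abstract homogenization can be
  read off by counting occurrences in words.
\<close>

lemma homogenized_counting:
  assumes "w \<noteq> []"
  obtains r C where "homogeneous_quasi_morphism SL2Z r"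
    "\<And>es n. \<bar>real n * r (word_matrix (positive_word es)) -
       signed_count w (concat (replicate n (positive_word es)))\<bar> \<le> C"
proof -
  obtain r where r: "homogeneous_quasi_morphism SL2Z r"
    "\<And>g. g \<in> carrier SL2Z \<Longrightarrow> \<bar>r g - counting_function w g\<bar> \<le> 2 * (24 * length w + 12)"
    using homogenization[OF group_SL2Z, of "counting_function w" "24 * length w + 12"]
      counting_function_defect[OF assms] by (auto simp: SL2Z_simps)
  have "\<bar>real n * r (word_matrix (positive_word es)) -
       signed_count w (concat (replicate n (positive_word es)))\<bar> \<le> 54 * length w + 27" for es n
  proof -
    let ?v = "concat (replicate n (positive_word es))"
    have "reduced ?v" by (simp add: concat_replicate_positive_word reduced_positive_word)
    from counting_function_approx[OF assms this eq_up_to_sign_refl]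
    have "\<bar>counting_function w (word_matrix ?v) - signed_count w ?v\<bar> \<le> 6 * length w + 3" .
    moreover have "\<bar>r (word_matrix ?v) - counting_function w (word_matrix ?v)\<bar> \<le> 48 * length w + 24"
      using r(2)[of "word_matrix ?v"] by (simp add: SL2Z_simps)
    moreover have "r (word_matrix ?v) = n * r (word_matrix (positive_word es))"
      using r(1) unfolding homogeneous_quasi_morphism_def word_matrix_power int_pow_int[symmetric]
      by (simp add: SL2Z_simps)
    ultimately show ?thesis by linarith
  qed
  then show ?thesis using r(1) that by blast
qed

lemma nonpos_if_multiples_bounded:
  fixes x :: real
  assumes "\<And>n::nat. n * x \<le> C"
  shows "x \<le> 0"
proof (rule ccontr)
  assume "\<not> x \<le> 0"
  then obtain n :: nat where "C < n * x" using reals_Archimedean3[of x] by auto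
  with assms[of n] show False by simp
qed

theorem proposition3:
  fixes h :: "int^2^2"
  assumes "hyperbolic h"
    and "\<not> conjugate_in SL2Z h (inv\<^bsub>SL2Z\<^esub> h)"
  shows "\<exists>r :: int^2^2 \<Rightarrow> real. homogeneous_quasi_morphism SL2Z r \<and> r h = 1 \<and>
           (\<forall>p. parabolic p \<longrightarrow> r p = 0)"
proof -
  have h: "det h = 1" "\<bar>trace h\<bar> > 2"
    using assms(1) by (auto simp: hyperbolic_def SL2Z_simps)
  then obtain es where es: "conjugate_up_to_sign h (word_matrix (positive_word es))"
    using conjugate_to_positive_word[of h] by auto
  define w where "w = positive_word es"
  have both: "True \<in> set es" "False \<in> set es"
    using positive_word_hyperbolic_iff[of es] conjugate_up_to_sign_abs_trace[OF es] h(2) by auto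
  then have w: "w \<noteq> []" by (auto simp: w_def)
  obtain r C where r: "homogeneous_quasi_morphism SL2Z r"
    and C: "\<And>es n. \<bar>real n * r (word_matrix (positive_word es)) -
       signed_count w (concat (replicate n (positive_word es)))\<bar> \<le> C"
    using homogenized_counting[OF w] by blast

  have no_inverse: "occurrences (word_inv w) (concat (replicate n w)) = {}" for n
  proof (rule ccontr)
    assume "occurrences (word_inv w) (concat (replicate n w)) \<noteq> {}"
    then obtain p q where "p @ word_inv w @ q = concat (replicate n w)"
      by (auto simp: occurrences_def)
    then obtain x y where xy: "w = x @ y" "word_inv w = y @ x"
      using factor_of_power_is_rotation[OF word_inv_simps(5)] by blast
    have "conjugate_up_to_sign h (word_matrix (x @ y))"
      using es unfolding xy(1)[symmetric] w_def .
    also have "conjugate_up_to_sign \<dots> (word_matrix (word_inv w))"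
      unfolding xy(2) by (rule conjugate_up_to_sign_rotate)
    also have "conjugate_up_to_sign \<dots> (adj2 (word_matrix w))"
      by (rule conjugate_up_to_signI[OF word_matrix_inv])
    also have "conjugate_up_to_sign \<dots> (adj2 h)"
      unfolding w_def by (rule conjugate_up_to_sign_adj2[OF conjugate_up_to_sign_sym[OF es]])
    finally have "conjugate_in SL2Z h (inv\<^bsub>SL2Z\<^esub> h)"
      using h by (intro conjugate_up_to_sign_inverse) auto
    with assms(2) show False ..
  qed
  have "real n * (1 - r (word_matrix w)) \<le> C" for n
    using C[of n es] card_occurrences_power[OF w, of n] no_inverse[of n]
    by (simp add: signed_count_def w_def algebra_simps abs_le_iff)
  then have "1 \<le> r (word_matrix w)"
    using nonpos_if_multiples_bounded[of "1 - r (word_matrix w)" C] by simp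
  then have pos: "r h > 0"
    using homogeneous_conjugate_up_to_sign[OF r es h(1)] by (simp add: w_def)

  have parabolic: "r p = 0" if "parabolic p" for p
  proof -
    have p: "det p = 1" "\<bar>trace p\<bar> = 2" using that by (auto simp: parabolic_def SL2Z_simps)
    then obtain es' where es': "conjugate_up_to_sign p (word_matrix (positive_word es'))"
      using conjugate_to_positive_word[of p] by auto
    then obtain e where e: "e \<notin> set es'"
      using positive_word_hyperbolic_iff[of es'] conjugate_up_to_sign_abs_trace[OF es'] p(2) by auto
    have "U e \<in> set w" "U e \<in> set (word_inv w)"
      using both set_positive_word[of e es] set_positive_word[of "\<not> e" es]
      by (cases e; force simp: w_def word_inv_def)+
    moreover have "U e \<notin> set (concat (replicate n (positive_word es')))" for n
      using e by (auto simp: set_positive_word)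
    ultimately have "occurrences w (concat (replicate n (positive_word es'))) = {}"
      and "occurrences (word_inv w) (concat (replicate n (positive_word es'))) = {}" for n
      using occurrences_empty by metis+
    then have "real n * \<bar>r (word_matrix (positive_word es'))\<bar> \<le> C" for n
      using C[of n es'] by (simp add: signed_count_def abs_mult)
    then have "r (word_matrix (positive_word es')) = 0"
      using nonpos_if_multiples_bounded[of "\<bar>r (word_matrix (positive_word es'))\<bar>" C] by simp
    then show ?thesis using homogeneous_conjugate_up_to_sign[OF r es' p(1)] by simp
  qed
  have "homogeneous_quasi_morphism SL2Z (\<lambda>g. (1 / r h) * r g)"
    by (rule homogeneous_quasi_morphism_scale[OF r])
  then show ?thesis
    using pos parabolic by (intro exI[of _ "\<lambda>g. (1 / r h) * r g"]) simp
qed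

end
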